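(* Let $M$ be an $m$-dimensional closed manifold $(m\geq 1)$, and let $i : M\to \mathbb{R}^\ell$ $(m+1\leq \ell)$ be an embedding. Then there exist $p_1,\ldots,p_{m+1}\in i(M)$ and $p_{m+2},\ldots,p_\ell\in \mathbb{R}^\ell$ such that $D_{(p_1,\ldots,p_\ell)}\circ i : M\rightarrow \mathbb{R}^\ell$ is an embedding.
   Context: All manifolds and mappings are of class $C^\infty$. A closed manifold is a compact manifold without boundary. $d(x,y)=\sqrt{\sum_{j=1}^n(x_j-y_j)^2}$ is the Euclidean distance on $\mathbb{R}^n$. For points $p_1,\ldots,p_\ell\in\mathbb{R}^n$ ($\ell\ge1$), the distance-squared mapping $D_{(p_1,\ldots,p_\ell)}:\mathbb{R}^n\to\mathbb{R}^\ell$ is defined by $D_{(p_1,\ldots,p_\ell)}(x)=(d^2(p_1,x),\ldots,d^2(p_\ell,x))$, where $d^2(p,x)=d(p,x)^2$. Here it is used with $n=\ell$. *)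

theory Defs
  imports "HOL-Analysis.Analysis"
begin

text \<open>Both notions are meant for open \<open>S\<close>. Since the domain is finite-dimensional,
  requiring every directional derivative \<open>\<lambda>x. Df(x) v\<close> to be \<open>C\<^sup>k\<close> is the same as requiring
  the derivative, as an operator-valued map, to be \<open>C\<^sup>k\<close>.\<close>

primrec Ck_on :: "nat \<Rightarrow> 'a::euclidean_space set \<Rightarrow> ('a \<Rightarrow> 'b::euclidean_space) \<Rightarrow> bool" where
  "Ck_on 0 S f \<longleftrightarrow> continuous_on S f"
| "Ck_on (Suc k) S f \<longleftrightarrow>
     (\<forall>x\<in>S. f differentiable (at x)) \<and>
     (\<forall>v. Ck_on k S (\<lambda>x. frechet_derivative f (at x) v))"

definition smooth_on :: "'a::euclidean_space set \<Rightarrow> ('a \<Rightarrow> 'b::euclidean_space) \<Rightarrow> bool" where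
  "smooth_on S f \<longleftrightarrow> (\<forall>k. Ck_on k S f)"

text \<open>A chart is a pair \<open>(U, \<phi>)\<close>; only the restriction of \<open>\<phi>\<close> to \<open>U\<close> matters, and its inverse is
  \<open>inv_into U \<phi>\<close>. The dimension of the manifold is \<open>CARD('m)\<close>.\<close>

type_synonym ('a, 'm) chart = "'a set \<times> ('a \<Rightarrow> real ^ 'm)"

definition is_chart :: "'a topology \<Rightarrow> ('a, 'm::finite) chart \<Rightarrow> bool" where
  "is_chart M c \<longleftrightarrow> (case c of (U, \<phi>) \<Rightarrow>
     openin M U \<and> open (\<phi> ` U) \<and>
     homeomorphic_map (subtopology M U) (top_of_set (\<phi> ` U)) \<phi>)"

definition smooth_atlas :: "'a topology \<Rightarrow> ('a, 'm::finite) chart set \<Rightarrow> bool" where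
  "smooth_atlas M \<A> \<longleftrightarrow>
     (\<forall>c\<in>\<A>. is_chart M c) \<and>
     (\<Union>(U, \<phi>)\<in>\<A>. U) = topspace M \<and>
     (\<forall>(U, \<phi>)\<in>\<A>. \<forall>(V, \<psi>)\<in>\<A>. smooth_on (\<phi> ` (U \<inter> V)) (\<psi> \<circ> inv_into U \<phi>))"

text \<open>The atlas need not be maximal: it determines the smooth structure, and the notions below
  do not change when compatible charts are added.\<close>

definition smooth_manifold :: "'a topology \<Rightarrow> ('a, 'm::finite) chart set \<Rightarrow> bool" where
  "smooth_manifold M \<A> \<longleftrightarrow> Hausdorff_space M \<and> second_countable M \<and> smooth_atlas M \<A>"

text \<open>Charts map onto open subsets of Euclidean space, so there is no boundary.\<close>

definition closed_manifold :: "'a topology \<Rightarrow> ('a, 'm::finite) chart set \<Rightarrow> bool" where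
  "closed_manifold M \<A> \<longleftrightarrow> smooth_manifold M \<A> \<and> compact_space M"

definition smooth_map ::
    "('a, 'm::finite) chart set \<Rightarrow> ('a \<Rightarrow> real ^ 'l::finite) \<Rightarrow> bool" where
  "smooth_map \<A> f \<longleftrightarrow> (\<forall>(U, \<phi>)\<in>\<A>. smooth_on (\<phi> ` U) (f \<circ> inv_into U \<phi>))"

definition immersion ::
    "('a, 'm::finite) chart set \<Rightarrow> ('a \<Rightarrow> real ^ 'l::finite) \<Rightarrow> bool" where
  "immersion \<A> f \<longleftrightarrow> smooth_map \<A> f \<and>
     (\<forall>(U, \<phi>)\<in>\<A>. \<forall>x\<in>U. inj (frechet_derivative (f \<circ> inv_into U \<phi>) (at (\<phi> x))))"

definition smooth_embedding ::
    "'a topology \<Rightarrow> ('a, 'm::finite) chart set \<Rightarrow> ('a \<Rightarrow> real ^ 'l::finite) \<Rightarrow> bool" where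
  "smooth_embedding M \<A> f \<longleftrightarrow> immersion \<A> f \<and> embedding_map M euclidean f"

definition dist_sq_map :: "('l::finite \<Rightarrow> real ^ 'n::finite) \<Rightarrow> real ^ 'n \<Rightarrow> real ^ 'l" where
  "dist_sq_map p x = (\<chi> j. (dist (p j) x)\<^sup>2)"

end

theory Submission
  imports Defs
begin

text \<open>
  If the points \<open>p\<^sub>j\<close> span a hyperplane \<open>H\<close> affinely, the distance-squared map is, up to
  diffeomorphisms of the target, the fold of space along \<open>H\<close>: it identifies exactly the points that
  are mirror images in \<open>H\<close> (\<open>equidistant_imp_mirror\<close>), and its derivative is injective except on \<open>H\<close>,
  where the kernel is the normal line of \<open>H\<close> (\<open>dist_sq_kernel\<close>). So one needs a hyperplane \<open>H\<close>,
  spanned by points of which the first \<open>m + 1\<close> lie on the submanifold, such that no two different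
  points of the submanifold are mirror images in \<open>H\<close> and the normal of \<open>H\<close> is nowhere tangent to the
  submanifold along \<open>H\<close>.

  Let \<open>q\<close> be a point of the submanifold farthest from some point \<open>a\<close> outside it, and let \<open>H\<close> be
  orthogonal to \<open>n = q - a\<close>, slightly below \<open>q\<close> when height is measured by the inner product with \<open>n\<close>.
  The submanifold lies in the ball around \<open>a\<close> through \<open>q\<close>, so \<open>H\<close> cuts off only a small cap near \<open>q\<close>,
  and both members of a pair of mirror images have to be close to \<open>q\<close> (\<open>cap_of_farthest_point\<close>). Near
  \<open>q\<close> the submanifold is a graph over its tangent space, to which \<open>n\<close> is normal
  (\<open>immersion_local_projection\<close>); hence no two different points of it differ by a multiple of \<open>n\<close>, and
  \<open>n\<close> is not tangent to it. This settles both requirements, for every \<open>H\<close> close enough to \<open>q\<close>.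

  For the first \<open>m + 1\<close> points, choose \<open>m + 1\<close> rays in the tangent space that point to the vertices of
  a simplex around the origin. The curves on the submanifold above these rays start at the peak \<open>q\<close>
  and descend, so each of them crosses \<open>H\<close> (\<open>level_point_over_ray\<close>). The crossing points are affinely
  independent (\<open>independent_secants\<close>) and can be completed to an affine basis of \<open>H\<close>
  (\<open>affine_independent_extend_to_hyperplane\<close>). An injective immersion of a compact manifold is an
  embedding.
\<close>

section \<open>The calculus of \<open>C\<^sup>k\<close> maps\<close>

text \<open>Over a non-open \<open>S\<close> this would fail, because the derivative in \<^const>\<open>Ck_on\<close> sees a full
  neighbourhood of each point.\<close>

lemma Ck_on_cong:
  assumes "open S" "\<And>x. x \<in> S \<Longrightarrow> f x = g x" "Ck_on k S f"
  shows "Ck_on k S g"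
  using assms(2,3)
proof (induction k arbitrary: f g)
  case 0
  then show ?case by (simp cong: continuous_on_cong)
next
  case (Suc k)
  have der: "(g has_derivative frechet_derivative f (at x)) (at x)" if "x \<in> S" for x
    using Suc.prems that \<open>open S\<close>
    by (auto simp: frechet_derivative_works intro: has_derivative_transform_within_open)
  then have "frechet_derivative f (at x) = frechet_derivative g (at x)" if "x \<in> S" for x
    using that frechet_derivative_at by blast
  then have "Ck_on k S (\<lambda>x. frechet_derivative g (at x) v)" for v
    using Suc.IH[of "\<lambda>x. frechet_derivative f (at x) v" "\<lambda>x. frechet_derivative g (at x) v"]
      Suc.prems(2) by simp
  with der show ?case unfolding Ck_on.simps differentiable_def by blast
qed

text \<open>The derivative \<open>f'\<close> need only be the right one on \<open>S\<close>, whereas \<^const>\<open>frechet_derivative\<close> is a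
  choice made at every point; this rule hides that difference from the closure properties below.\<close>

lemma Ck_on_SucI:
  assumes "open S" "\<And>x. x \<in> S \<Longrightarrow> (f has_derivative f' x) (at x)"
    "\<And>v. Ck_on k S (\<lambda>x. f' x v)"
  shows "Ck_on (Suc k) S f"
proof -
  have "frechet_derivative f (at x) = f' x" if "x \<in> S" for x
    using assms(2)[OF that] frechet_derivative_at by metis
  then have "Ck_on k S (\<lambda>x. frechet_derivative f (at x) v)" for v
    by (intro Ck_on_cong[OF assms(1) _ assms(3)[of v]]) simp
  with assms(2) show ?thesis unfolding Ck_on.simps differentiable_def by blast
qed

lemma Ck_on_SucD:
  assumes "Ck_on (Suc k) S f"
  shows "x \<in> S \<Longrightarrow> (f has_derivative frechet_derivative f (at x)) (at x)"
    and "Ck_on k S (\<lambda>x. frechet_derivative f (at x) v)"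
  using assms by (simp_all add: frechet_derivative_works)

lemma Ck_on_Suc_imp_Ck_on: "Ck_on (Suc k) S f \<Longrightarrow> Ck_on k S f"
proof (induction k arbitrary: f)
  case 0
  then show ?case
    by (auto intro: differentiable_imp_continuous_within continuous_at_imp_continuous_on)
next
  case (Suc k)
  then show ?case by (metis Ck_on.simps(2))
qed

lemma Ck_on_const: "open S \<Longrightarrow> Ck_on k S (\<lambda>x. c)"
proof (induction k arbitrary: c)
  case (Suc k)
  then show ?case by (intro Ck_on_SucI[where f' = "\<lambda>x v. 0"]) auto
qed simp

lemma Ck_on_add:
  assumes "open S"
  shows "Ck_on k S f \<Longrightarrow> Ck_on k S g \<Longrightarrow> Ck_on k S (\<lambda>x. f x + g x)"
proof (induction k arbitrary: f g)
  case 0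
  then show ?case by (simp add: continuous_on_add)
next
  case (Suc k)
  note d = Ck_on_SucD[OF Suc.prems(1)] Ck_on_SucD[OF Suc.prems(2)]
  show ?case
    by (rule Ck_on_SucI[where f' = "\<lambda>x v. frechet_derivative f (at x) v + frechet_derivative g (at x) v"])
      (simp_all add: assms d Suc.IH has_derivative_add)
qed

lemma Ck_on_sum:
  assumes "open S"
  shows "(\<And>j. j \<in> J \<Longrightarrow> Ck_on k S (f j)) \<Longrightarrow> Ck_on k S (\<lambda>x. \<Sum>j\<in>J. f j x)"
proof (induction J rule: infinite_finite_induct)
  case (insert a J)
  have "Ck_on k S (\<lambda>x. f a x + (\<Sum>j\<in>J. f j x))"
  proof (rule Ck_on_add[OF assms])
    show "Ck_on k S (f a)" using insert.prems by blast
    show "Ck_on k S (\<lambda>x. \<Sum>j\<in>J. f j x)" using insert.prems insert.IH by blast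
  qed
  then show ?case by (simp only: sum.insert[OF insert.hyps])
next
  case empty
  show ?case using Ck_on_const[OF assms, of k 0] by (simp only: sum.empty)
next
  case (infinite J)
  show ?case using Ck_on_const[OF assms, of k 0] by (simp only: sum.infinite[OF infinite.hyps])
qed

text \<open>By the Leibniz rule the derivative is again a sum of two values of \<open>B\<close>, so the induction goes
  through for products of any kind at once. Both scaling of vectors and the inner product are
  instances.\<close>

lemma Ck_on_bounded_bilinear:
  fixes B :: "'b::euclidean_space \<Rightarrow> 'c::euclidean_space \<Rightarrow> 'd::euclidean_space"
  assumes "open S" "bounded_bilinear B"
  shows "Ck_on k S f \<Longrightarrow> Ck_on k S g \<Longrightarrow> Ck_on k S (\<lambda>x. B (f x) (g x))"
proof (induction k arbitrary: f g)
  case 0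
  then have "continuous_on S f" "continuous_on S g" by simp_all
  then show ?case
    unfolding Ck_on.simps by (rule bounded_bilinear.continuous_on[OF assms(2)])
next
  case (Suc k)
  note d = Ck_on_SucD[OF Suc.prems(1)] Ck_on_SucD[OF Suc.prems(2)]
  note c = Ck_on_Suc_imp_Ck_on[OF Suc.prems(1)] Ck_on_Suc_imp_Ck_on[OF Suc.prems(2)]
  show ?case
  proof (rule Ck_on_SucI[where
        f' = "\<lambda>x v. B (f x) (frechet_derivative g (at x) v) + B (frechet_derivative f (at x) v) (g x)"])
    show "Ck_on k S (\<lambda>x. B (f x) (frechet_derivative g (at x) v) + B (frechet_derivative f (at x) v) (g x))"
      for v
      using Suc.IH[OF c(1) d(4)[of v]] Suc.IH[OF d(2)[of v] c(2)] by (rule Ck_on_add[OF assms(1)])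
  qed (use assms(1) bounded_bilinear.FDERIV[OF assms(2) d(1,3)] in auto)
qed

text \<open>Each component of the map is the inner product of \<open>F - p\<^sub>j\<close> with itself.\<close>

lemma smooth_on_dist_sq_map:
  fixes F :: "'b::euclidean_space \<Rightarrow> real ^ 'n::finite" and p :: "'l::finite \<Rightarrow> real ^ 'n"
  assumes "open S" "smooth_on S F"
  shows "smooth_on S (\<lambda>x. dist_sq_map p (F x))"
  unfolding smooth_on_def
proof
  fix k
  let ?G = "\<lambda>j x. F x + - p j"
  have G: "Ck_on k S (?G j)" for j
    using assms by (intro Ck_on_add Ck_on_const) (auto simp: smooth_on_def)
  have "Ck_on k S (\<lambda>x. \<Sum>j\<in>UNIV. (?G j x \<bullet> ?G j x) *\<^sub>R (axis j 1 :: real ^ 'l))"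
    by (intro Ck_on_sum Ck_on_bounded_bilinear[OF _ bounded_bilinear_scaleR]
        Ck_on_bounded_bilinear[OF _ bounded_bilinear_inner] Ck_on_const G assms)
  moreover have "(\<lambda>x. \<Sum>j\<in>UNIV. (?G j x \<bullet> ?G j x) *\<^sub>R (axis j 1 :: real ^ 'l)) =
      (\<lambda>x. dist_sq_map p (F x))"
    by (auto simp: fun_eq_iff vec_eq_iff dist_sq_map_def axis_def if_distrib sum.If_cases
        dist_norm power2_norm_eq_inner inner_commute algebra_simps cong: if_cong)
  ultimately show "Ck_on k S (\<lambda>x. dist_sq_map p (F x))" by simp
qed

lemma dist_sq_map_has_derivative:
  fixes p :: "'l::finite \<Rightarrow> real ^ 'n::finite"
  assumes "(F has_derivative F') (at z)"
  shows "((\<lambda>x. dist_sq_map p (F x)) has_derivative (\<lambda>v. \<chi> j. 2 * ((F z - p j) \<bullet> F' v))) (at z)"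
proof -
  have "((\<lambda>x. dist_sq_map p (F x) $ j) has_derivative (\<lambda>v. 2 * ((F z - p j) \<bullet> F' v))) (at z)" for j
    unfolding dist_sq_map_def dist_norm power2_norm_eq_inner
    by (simp, rule has_derivative_eq_rhs, (rule derivative_intros assms)+)
       (auto simp: inner_commute algebra_simps)
  then have "((\<lambda>x. \<chi> j. dist_sq_map p (F x) $ j) has_derivative
      (\<lambda>v. \<chi> j. 2 * ((F z - p j) \<bullet> F' v))) (at z)"
    by (subst has_derivative_componentwise_within)
       (auto simp: Basis_vec_def inner_axis)
  then show ?thesis by simp
qed

section \<open>Points that span a hyperplane affinely\<close>

lemma extend_independent_family:
  fixes d :: "'i \<Rightarrow> 'b::euclidean_space"
  assumes "finite I" "J \<subseteq> I" "inj_on d J" "independent (d ` J)" "d ` J \<subseteq> S" "card I = dim S"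
  obtains e where "\<And>j. j \<in> J \<Longrightarrow> e j = d j" "e ` I \<subseteq> S" "S \<subseteq> span (e ` I)"
proof -
  obtain B where B: "d ` J \<subseteq> B" "B \<subseteq> S" "independent B" "S \<subseteq> span B"
    using maximal_independent_subset_extend[OF assms(5,4)] .
  have "finite J" using assms(1,2) finite_subset by blast
  have "card B = card I"
    using basis_card_eq_dim[OF B(2,4,3)] assms(6) by simp
  moreover have "card (d ` J) = card J" using assms(3) by (rule card_image)
  ultimately have "card (I - J) = card (B - d ` J)"
    using B(1) assms(2) \<open>finite J\<close> by (simp add: card_Diff_subset)
  then obtain f where f: "bij_betw f (I - J) (B - d ` J)"
    using finite_same_card_bij[of "I - J" "B - d ` J"] assms(1) B(3) finiteI_independent by auto
  let ?e = "\<lambda>j. if j \<in> J then d j else f j"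
  have "?e ` I = d ` J \<union> f ` (I - J)" using assms(2) by auto
  also have "\<dots> = B" using f B(1) by (auto simp: bij_betw_def)
  finally show ?thesis using that[of ?e] B by auto
qed

text \<open>Independence of a set of vectors says nothing about repetitions in a family, so injectivity has
  to be derived from the triviality of the relations as well.\<close>

lemma independent_family_if_scalars_zero:
  fixes d :: "'k::finite \<Rightarrow> 'b::real_vector"
  assumes "\<And>a. (\<Sum>k\<in>UNIV. a k *\<^sub>R d k) = 0 \<Longrightarrow> (\<forall>k. a k = 0)"
  shows "inj d" "independent (range d)"
proof -
  show inj: "inj d"
  proof (rule injI, rule ccontr)
    fix x y assume eq: "d x = d y" and "x \<noteq> y"
    let ?a = "\<lambda>k. if k = x then 1 else if k = y then - 1 else (0::real)"
    have "(\<Sum>k\<in>UNIV. ?a k *\<^sub>R d k) = (\<Sum>k\<in>{x, y}. ?a k *\<^sub>R d k)"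
      by (rule sum.mono_neutral_right) auto
    also have "\<dots> = 0" using eq \<open>x \<noteq> y\<close> by simp
    finally have "?a x = 0" using assms[of ?a] by metis
    then show False by simp
  qed
  show "independent (range d)"
  proof (rule independent_if_scalars_zero)
    fix f x assume s: "(\<Sum>x\<in>range d. f x *\<^sub>R x) = 0" and "x \<in> range d"
    then obtain k where "x = d k" by auto
    moreover have "(\<Sum>k\<in>UNIV. f (d k) *\<^sub>R d k) = 0"
      using s by (simp add: sum.reindex[OF inj])
    ultimately show "f x = 0" using assms[of "\<lambda>k. f (d k)"] by blast
  qed simp
qed

text \<open>The vectors \<open>e\<^sub>1, \<dots>, e\<^sub>m\<close> and \<open>- \<Sum> e\<^sub>k\<close> are the vertices of a simplex around the origin, and they stay
  affinely independent when each is rescaled by a positive factor of its own. Affine independence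
  lifts along the linear map \<open>L\<close>. The factors are arbitrary because the points \<open>P\<^sub>k\<close> will be found on
  given rays, but at distances that cannot be controlled.\<close>

lemma independent_secants:
  fixes P :: "'m::finite \<Rightarrow> 'b::real_vector" and L :: "'b \<Rightarrow> real ^ 'm"
  assumes "linear L" "\<And>k. t k > 0" "\<And>k. L (P k) = u + t k *\<^sub>R axis k 1"
    "s > 0" "L P0 = u - s *\<^sub>R (\<Sum>k\<in>UNIV. axis k 1)"
  shows "inj (\<lambda>k. P k - P0)" "independent (range (\<lambda>k. P k - P0))"
proof -
  have "\<forall>k. a k = 0" if a: "(\<Sum>k\<in>UNIV. a k *\<^sub>R (P k - P0)) = 0" for a
  proof -
    have LP: "L (P k - P0) $ j = (if k = j then t k else 0) + s" for k j
      using assms(1,3,5) by (simp add: linear_diff axis_def)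
    have "L (\<Sum>k\<in>UNIV. a k *\<^sub>R (P k - P0)) $ j = (\<Sum>k\<in>UNIV. a k * L (P k - P0) $ j)" for j
      using assms(1) by (simp add: linear_sum linear_scale)
    also have "\<dots> j = (\<Sum>k\<in>UNIV. (if k = j then a k * t k else 0) + s * a k)" for j
      unfolding LP by (intro sum.cong) (auto simp: algebra_simps)
    also have "\<dots> j = a j * t j + s * sum a UNIV" for j
      by (simp add: sum.distrib sum_distrib_left)
    finally have "L (\<Sum>k\<in>UNIV. a k *\<^sub>R (P k - P0)) $ j = a j * t j + s * sum a UNIV" for j .
    then have eq: "a j * t j + s * sum a UNIV = 0" for j
      using a assms(1) by (simp add: linear_0 vec_eq_iff)
    have "sum a UNIV = 0"
    proof (rule ccontr)
      assume "sum a UNIV \<noteq> 0"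
      then consider "sum a UNIV > 0" | "sum a UNIV < 0" by linarith
      then show False
      proof cases
        case 1
        then have "a j \<le> 0" for j
          using eq[of j] assms(2)[of j] assms(4)
          by (smt (verit) mult_pos_pos)
        then have "sum a UNIV \<le> 0" by (simp add: sum_nonpos)
        with 1 show False by simp
      next
        case 2
        then have "a j \<ge> 0" for j
          using eq[of j] assms(2)[of j] assms(4)
          by (smt (verit) mult_pos_neg mult_neg_pos)
        then have "sum a UNIV \<ge> 0" by (simp add: sum_nonneg)
        with 2 show False by simp
      qed
    qed
    with eq assms(2) show ?thesis by (metis add.right_neutral mult_eq_0_iff mult_zero_right less_irrefl)
  qed
  then show "inj (\<lambda>k. P k - P0)" "independent (range (\<lambda>k. P k - P0))"
    using independent_family_if_scalars_zero[of "\<lambda>k. P k - P0"] by blast+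
qed

text \<open>The component of \<open>w\<close> in the hyperplane is orthogonal to \<open>w\<close>, hence to itself.\<close>

lemma orthogonal_to_hyperplane_span:
  fixes n w :: "'b::euclidean_space"
  assumes "{x. n \<bullet> x = 0} \<subseteq> span E" "\<And>e. e \<in> E \<Longrightarrow> e \<bullet> w = 0" "n \<noteq> 0"
  obtains s where "w = s *\<^sub>R n"
proof -
  let ?r = "w - ((n \<bullet> w) / (n \<bullet> n)) *\<^sub>R n"
  have nr: "n \<bullet> ?r = 0" using assms(3) by (simp add: inner_diff_right)
  have "orthogonal w ?r"
    using orthogonal_to_span[of ?r E w] nr assms(1,2)
    by (auto simp: orthogonal_def inner_commute)
  then have "?r \<bullet> ?r = 0"
    using nr by (simp add: orthogonal_def inner_diff_left)
  then have "?r = 0" by simp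
  then show ?thesis using that by (metis eq_iff_diff_eq_0)
qed

text \<open>The secants from \<open>P0\<close> extend to a basis of the direction space of the hyperplane, which is added
  to \<open>P0\<close> to give the remaining points. The last conclusion is the form in which spanning is used: a vector
  orthogonal to all differences of the points is normal to the hyperplane.\<close>

lemma affine_independent_extend_to_hyperplane:
  fixes P :: "'m::finite \<Rightarrow> real ^ 'l::finite" and idx :: "nat \<Rightarrow> 'l"
  assumes "bij_betw idx {1..CARD('l)} UNIV" "CARD('m) + 1 \<le> CARD('l)"
    and "n \<noteq> 0" "\<And>k. n \<bullet> P k = c" "n \<bullet> P0 = c"
    and "inj (\<lambda>k. P k - P0)" "independent (range (\<lambda>k. P k - P0))"
  obtains p :: "'l \<Rightarrow> real ^ 'l"
  where "\<forall>k\<in>{1..CARD('m) + 1}. p (idx k) \<in> insert P0 (range P)"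
    and "\<forall>j. n \<bullet> p j = c"
    and "\<forall>w. (\<forall>j j'. (p j - p j') \<bullet> w = 0) \<longrightarrow> (\<exists>s. w = s *\<^sub>R n)"
proof -
  let ?H = "{x. n \<bullet> x = 0}"
  define J where "J = idx ` {2..CARD('m) + 1}"
  have inj_idx: "inj_on idx {1..CARD('l)}" using assms(1) by (rule bij_betw_imp_inj_on)
  then have "inj_on idx {2..CARD('m) + 1}" using assms(2) by (auto elim: inj_on_subset)
  then have "card J = CARD('m)" by (simp add: J_def card_image)
  then obtain \<tau> :: "'l \<Rightarrow> 'm" where \<tau>: "bij_betw \<tau> J UNIV"
    using finite_same_card_bij[of J "UNIV :: 'm set"] J_def by auto
  have i1: "idx 1 \<notin> J"
    using inj_idx assms(2) by (auto simp: J_def dest!: inj_onD)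
  let ?d = "\<lambda>j. P (\<tau> j) - P0"
  have dJ: "?d ` J = range (\<lambda>k. P k - P0)"
  proof -
    have "?d ` J = (\<lambda>k. P k - P0) ` \<tau> ` J" by (simp add: image_image)
    then show ?thesis using \<tau> by (simp add: bij_betw_def)
  qed
  obtain e where e: "\<And>j. j \<in> J \<Longrightarrow> e j = ?d j" "e ` (UNIV - {idx 1}) \<subseteq> ?H"
    "?H \<subseteq> span (e ` (UNIV - {idx 1}))"
  proof (rule extend_independent_family[of "UNIV - {idx 1}" J ?d ?H])
    show "inj_on ?d J"
      using \<tau> assms(6) by (auto simp: bij_betw_def inj_on_def)
    show "independent (?d ` J)" using dJ assms(7) by simp
    show "?d ` J \<subseteq> ?H" using assms(4,5) by (auto simp: inner_diff_right)
    show "card (UNIV - {idx 1}) = dim ?H"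
      using dim_hyperplane[OF assms(3)] by (simp add: card_Diff_singleton)
  qed (use i1 in auto)
  define p where "p j = (if j = idx 1 then P0 else P0 + e j)" for j
  show ?thesis
  proof (rule that[of p]; (intro ballI allI impI)?)
    fix k assume "k \<in> {1..CARD('m) + 1}"
    then consider "k = 1" | "idx k \<in> J" unfolding J_def by force
    then show "p (idx k) \<in> insert P0 (range P)"
      using i1 by cases (auto simp: p_def e(1))
  next
    fix j show "n \<bullet> p j = c"
      using e(2) assms(5) by (auto simp: p_def inner_add_right)
  next
    fix w assume w: "\<forall>j j'. (p j - p j') \<bullet> w = 0"
    have "x \<bullet> w = 0" if x: "x \<in> e ` (UNIV - {idx 1})" for x
    proof -
      from x obtain j where "j \<noteq> idx 1" "x = e j" by auto
      then show ?thesis using w[rule_format, of j "idx 1"] by (simp add: p_def)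
    qed
    then show "\<exists>s. w = s *\<^sub>R n"
      using orthogonal_to_hyperplane_span[OF e(3) _ assms(3)] by metis
  qed
qed

section \<open>The fold along a hyperplane\<close>

text \<open>Two different points have the same distance to every \<open>p\<^sub>j\<close> only if their perpendicular bisector
  contains all \<open>p\<^sub>j\<close>. As these span the hyperplane \<open>n \<bullet> x = c\<close>, the bisector is that hyperplane: the
  points are mirror images in it.\<close>

lemma equidistant_imp_mirror:
  fixes x y n :: "'b::euclidean_space"
  assumes "\<forall>j. n \<bullet> p j = c"
    and "\<forall>w. (\<forall>j j'. (p j - p j') \<bullet> w = 0) \<longrightarrow> (\<exists>s. w = s *\<^sub>R n)"
    and "\<And>j. dist (p j) x = dist (p j) y" "x \<noteq> y"
  shows "\<exists>s. x - y = s *\<^sub>R n" "n \<bullet> x + n \<bullet> y = 2 * c"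
proof -
  have eq: "2 * (p j \<bullet> (x - y)) = x \<bullet> x - y \<bullet> y" for j
  proof -
    have "(norm (p j - x))\<^sup>2 = (norm (p j - y))\<^sup>2" using assms(3)[of j] by (simp add: dist_norm)
    then show ?thesis
      by (simp add: power2_norm_eq_inner inner_commute algebra_simps)
  qed
  have "(p j - p j') \<bullet> (x - y) = 0" for j j'
    using eq[of j] eq[of j'] by (simp add: inner_diff_left)
  then show "\<exists>s. x - y = s *\<^sub>R n" using assms(2) by blast
  then obtain s where s: "x - y = s *\<^sub>R n" by blast
  with assms(4) have "s \<noteq> 0" by auto
  have "x \<bullet> x - y \<bullet> y = (x - y) \<bullet> (x + y)" by (simp add: inner_commute algebra_simps)
  also have "\<dots> = s * (n \<bullet> x + n \<bullet> y)" by (simp add: s inner_add_right distrib_left)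
  finally have "s * (n \<bullet> x + n \<bullet> y) = s * (2 * c)"
    using eq[of undefined] assms(1)[rule_format, of undefined] by (auto simp: s inner_commute[of _ n])
  with \<open>s \<noteq> 0\<close> show "n \<bullet> x + n \<bullet> y = 2 * c" by simp
qed

text \<open>The infinitesimal version of the mirror property: the vectors \<open>x - p\<^sub>j\<close> span the whole space unless
  \<open>x\<close> lies in the hyperplane, and then they span its direction. So the distance-squared map is
  singular on the hyperplane only, and there it kills just the normal.\<close>

lemma dist_sq_kernel:
  fixes x w n :: "'b::euclidean_space"
  assumes "\<forall>j. n \<bullet> p j = c"
    and "\<forall>w. (\<forall>j j'. (p j - p j') \<bullet> w = 0) \<longrightarrow> (\<exists>s. w = s *\<^sub>R n)"
    and "\<And>j. (x - p j) \<bullet> w = 0" "w \<noteq> 0"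
  shows "\<exists>s. w = s *\<^sub>R n" "n \<bullet> x = c"
proof -
  have "(p j - p j') \<bullet> w = 0" for j j'
    using assms(3)[of j] assms(3)[of j'] by (simp add: inner_diff_left)
  then show "\<exists>s. w = s *\<^sub>R n" using assms(2) by blast
  then obtain s where s: "w = s *\<^sub>R n" by blast
  with assms(4) have "s \<noteq> 0" by auto
  have "s * (n \<bullet> x - n \<bullet> p undefined) = 0"
    using assms(3)[of undefined] by (simp add: s inner_diff_left inner_commute[of n])
  with \<open>s \<noteq> 0\<close> assms(1) show "n \<bullet> x = c" by simp
qed

section \<open>A sheet of the submanifold near an extremal point\<close>

text \<open>The ball around \<open>a\<close> through \<open>q\<close> is strictly convex: a point of the ball that is almost as high as
  \<open>q\<close> in the direction \<open>q - a\<close> is close to \<open>q\<close>, with an explicit bound.\<close>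

lemma cap_of_farthest_point:
  fixes a x q :: "'b::euclidean_space"
  assumes "dist a x \<le> dist a q"
  shows "(dist x q)\<^sup>2 \<le> 2 * ((q - a) \<bullet> q - (q - a) \<bullet> x)"
proof -
  have "(norm (a - x))\<^sup>2 \<le> (norm (a - q))\<^sup>2" using assms by (simp add: dist_norm power_mono)
  then show ?thesis
    by (simp add: dist_norm power2_norm_eq_inner inner_commute algebra_simps)
qed

text \<open>With \<open>A\<close> the derivative of \<open>F\<close> at \<open>z0\<close>, take \<open>L\<close> to be the adjoint of \<open>A\<close>. It vanishes on the normal
  space of the image of \<open>A\<close>, while \<open>L A\<close> is invertible because \<open>A\<close> is injective. The inverse function
  theorem then makes \<open>L \<circ> F\<close> a local diffeomorphism. Thus near \<open>F z0\<close> the sheet is a graph over the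
  tangent space: the line through a point of it in a normal direction of \<open>A\<close> neither meets it again
  nor touches it.\<close>

lemma immersion_local_projection:
  fixes F :: "'c::euclidean_space \<Rightarrow> 'b::euclidean_space"
  assumes "open T" "Ck_on 1 T F" "z0 \<in> T" "inj (frechet_derivative F (at z0))"
  obtains L :: "'b \<Rightarrow> 'c" and W V g where "linear L"
    and "\<forall>n. (\<forall>v. n \<bullet> frechet_derivative F (at z0) v = 0) \<longrightarrow> L n = 0"
    and "open W" "W \<subseteq> T" "z0 \<in> W" "open V" "homeomorphism W V (L \<circ> F) g"
    and "\<forall>z\<in>W. inj (\<lambda>v. L (frechet_derivative F (at z) v))"
proof -
  let ?D = "\<lambda>z. frechet_derivative F (at z)"
  have "Ck_on (Suc 0) T F" using assms(2) by simp
  note der = Ck_on_SucD(1)[OF this] and cont = Ck_on_SucD(2)[OF this]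
  define L where "L = adjoint (?D z0)"
  have linD: "linear (?D z0)" using der[OF assms(3)] has_derivative_linear by blast
  have linL: "linear L" unfolding L_def using linD by (rule adjoint_linear)
  then have blL: "bounded_linear L" by (simp add: linear_conv_bounded_linear)
  have ker: "L n = 0" if "\<And>v. n \<bullet> ?D z0 v = 0" for n
  proof -
    have "L n \<bullet> L n = 0"
      using that[of "L n"] adjoint_works[OF linD, of "L n" n] by (simp add: L_def inner_commute)
    then show ?thesis by simp
  qed
  define f' where "f' z = Blinfun (\<lambda>v. L (?D z v))" for z
  have f': "blinfun_apply (f' z) = (\<lambda>v. L (?D z v))" if "z \<in> T" for z
    unfolding f'_def using der[OF that]
    by (intro bounded_linear_Blinfun_apply bounded_linear_compose[OF blL])
      (rule has_derivative_bounded_linear)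
  have derLF: "((L \<circ> F) has_derivative blinfun_apply (f' z)) (at z)" if "z \<in> T" for z
    unfolding f'[OF that] o_def using bounded_linear.has_derivative[OF blL der[OF that]] .
  have contf': "continuous_on T f'"
  proof (rule continuous_on_blinfun_componentwise)
    fix v
    have "continuous_on T (\<lambda>z. L (?D z v))"
      using cont[of v] by (intro bounded_linear.continuous_on[OF blL]) simp
    then show "continuous_on T (\<lambda>z. blinfun_apply (f' z) v)"
      by (rule continuous_on_eq) (simp add: f')
  qed
  have "linear (blinfun_apply (f' z0))" using blinfun.bounded_linear_right bounded_linear.linear by blast
  moreover have "inj (blinfun_apply (f' z0))"
  proof -
    have "v = 0" if "blinfun_apply (f' z0) v = 0" for v
    proof -
      have "?D z0 v \<bullet> ?D z0 v = v \<bullet> L (?D z0 v)"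
        using adjoint_works[OF linD, of v "?D z0 v"] by (simp add: L_def)
      also have "\<dots> = 0" using that f'[OF assms(3)] by simp
      finally have "?D z0 v = ?D z0 0" using linD by (simp add: linear_0)
      then show ?thesis using assms(4) by (simp add: inj_eq)
    qed
    then show ?thesis using linear_injective_0[OF \<open>linear (blinfun_apply (f' z0))\<close>] by blast
  qed
  ultimately obtain h where h: "linear h" "h \<circ> blinfun_apply (f' z0) = id"
    using linear_injective_left_inverse by blast
  have "Blinfun h o\<^sub>L f' z0 = id_blinfun"
    using h by (intro blinfun_eqI)
      (simp add: bounded_linear_Blinfun_apply linear_conv_bounded_linear fun_eq_iff)
  from inverse_function_theorem[OF assms(1) derLF contf' assms(3) this]
  obtain W V g g' where W: "open W" "W \<subseteq> T" "z0 \<in> W" "open V" "homeomorphism W V (L \<circ> F) g"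
    and bij: "\<And>y. y \<in> V \<Longrightarrow> bij (blinfun_apply (f' (g y)))"
    by metis
  have inj: "inj (\<lambda>v. L (?D z v))" if z: "z \<in> W" for z
  proof -
    have "(L \<circ> F) z \<in> V" "g ((L \<circ> F) z) = z" using W(5) z by (auto simp: homeomorphism_def)
    then have "bij (blinfun_apply (f' z))" using bij[of "(L \<circ> F) z"] by simp
    then show ?thesis using f' z W(2) by (auto simp: bij_def)
  qed
  show ?thesis by (rule that[OF linL _ W]) (use ker inj in blast)+
qed

text \<open>Lift the ray in direction \<open>v\<close> from \<open>L (F z0)\<close> to the sheet. The lifted curve starts at the peak and
  has dropped by a positive amount after some fixed time, so by the intermediate value theorem it
  passes through every level slightly below the peak.\<close>

lemma level_point_over_ray:
  fixes L :: "'b::euclidean_space \<Rightarrow> 'c::euclidean_space" and F :: "'c \<Rightarrow> 'b"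
  assumes hom: "homeomorphism W V (L \<circ> F) g" and "open V" "z0 \<in> W"
    and cont: "continuous_on W F"
    and top: "\<And>z. z \<in> W \<Longrightarrow> F z \<noteq> F z0 \<Longrightarrow> n \<bullet> F z < n \<bullet> F z0"
    and "v \<noteq> 0"
  shows "\<forall>\<^sub>F \<epsilon> in at_right 0. \<exists>t z. t > 0 \<and> z \<in> W \<and> n \<bullet> F z = n \<bullet> F z0 - \<epsilon> \<and>
    L (F z) = L (F z0) + t *\<^sub>R v"
proof -
  have LF: "L (F z) \<in> V" "g (L (F z)) = z" if "z \<in> W" for z
    using hom that by (auto simp: homeomorphism_def)
  have g: "g y \<in> W" "L (F (g y)) = y" if "y \<in> V" for y
    using hom that by (auto simp: homeomorphism_def)
  obtain r where r: "r > 0" "cball (L (F z0)) r \<subseteq> V"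
    using \<open>open V\<close> LF(1)[OF \<open>z0 \<in> W\<close>] open_contains_cball by blast
  define \<delta> where "\<delta> = r / norm v"
  have \<delta>: "\<delta> > 0" using r \<open>v \<noteq> 0\<close> by (simp add: \<delta>_def)
  have ray: "L (F z0) + t *\<^sub>R v \<in> V" if "t \<in> {0..\<delta>}" for t
  proof -
    have "t * norm v \<le> \<delta> * norm v" using that by (intro mult_right_mono) auto
    then have "norm (t *\<^sub>R v) \<le> r" using that \<open>v \<noteq> 0\<close> by (simp add: \<delta>_def)
    then have "L (F z0) + t *\<^sub>R v \<in> cball (L (F z0)) r" by (simp add: dist_norm)
    then show ?thesis using r by blast
  qed
  define \<gamma> where "\<gamma> t = g (L (F z0) + t *\<^sub>R v)" for t
  have \<gamma>: "\<gamma> t \<in> W" "L (F (\<gamma> t)) = L (F z0) + t *\<^sub>R v" if "t \<in> {0..\<delta>}" for t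
    using g[OF ray[OF that]] by (simp_all add: \<gamma>_def)
  have "continuous_on V g" using hom by (simp add: homeomorphism_def)
  then have "continuous_on {0..\<delta>} \<gamma>" unfolding \<gamma>_def
    by (rule continuous_on_compose2) (use ray in \<open>auto intro!: continuous_intros\<close>)
  then have "continuous_on {0..\<delta>} (\<lambda>t. F (\<gamma> t))"
    by (rule continuous_on_compose2[OF cont]) (use \<gamma> in auto)
  then have cont_h: "continuous_on {0..\<delta>} (\<lambda>t. n \<bullet> F (\<gamma> t))"
    by (intro continuous_intros)
  have \<gamma>0: "\<gamma> 0 = z0" using LF(2)[OF \<open>z0 \<in> W\<close>] by (simp add: \<gamma>_def)
  have "L (F (\<gamma> \<delta>)) \<noteq> L (F z0)" using \<gamma>(2)[of \<delta>] \<delta> \<open>v \<noteq> 0\<close> by simp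
  then have "F (\<gamma> \<delta>) \<noteq> F z0" by auto
  then have low: "n \<bullet> F (\<gamma> \<delta>) < n \<bullet> F z0" using top \<gamma>(1)[of \<delta>] \<delta> by simp
  show ?thesis unfolding eventually_at_right_field
  proof (rule exI[of _ "n \<bullet> F z0 - n \<bullet> F (\<gamma> \<delta>)"], intro conjI allI impI)
    show "0 < n \<bullet> F z0 - n \<bullet> F (\<gamma> \<delta>)" using low by simp
  next
    fix \<epsilon> assume \<epsilon>: "0 < \<epsilon>" "\<epsilon> < n \<bullet> F z0 - n \<bullet> F (\<gamma> \<delta>)"
    then obtain t where t: "0 \<le> t" "t \<le> \<delta>" "n \<bullet> F (\<gamma> t) = n \<bullet> F z0 - \<epsilon>"
      using IVT2'[of "\<lambda>t. n \<bullet> F (\<gamma> t)" \<delta> "n \<bullet> F z0 - \<epsilon>" 0] cont_h \<delta> \<gamma>0 by auto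
    with \<epsilon> \<gamma>0 have "t \<noteq> 0" by auto
    with t \<gamma>[of t] show "\<exists>t z. t > 0 \<and> z \<in> W \<and> n \<bullet> F z = n \<bullet> F z0 - \<epsilon> \<and>
        L (F z) = L (F z0) + t *\<^sub>R v"
      by (intro exI[of _ t] exI[of _ "\<gamma> t"]) auto
  qed
qed

section \<open>Charts\<close>

lemma is_chart_props:
  assumes "is_chart M (U, \<phi>)"
  shows is_chart_openin: "openin M U"
    and is_chart_inj_on: "inj_on \<phi> U"
    and is_chart_open_image: "\<And>X. openin M X \<Longrightarrow> open (\<phi> ` (U \<inter> X))"
    and is_chart_openin_preimage: "\<And>W. open W \<Longrightarrow> openin M {x \<in> U. \<phi> x \<in> W}"
proof -
  from assms have U: "openin M U" and op: "open (\<phi> ` U)"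
    and hom: "homeomorphic_map (subtopology M U) (top_of_set (\<phi> ` U)) \<phi>"
    by (auto simp: is_chart_def)
  have topU: "topspace (subtopology M U) = U" using openin_subset[OF U] by auto
  show "openin M U" by fact
  show "inj_on \<phi> U" using homeomorphic_imp_injective_map[OF hom] unfolding topU .
  show "open (\<phi> ` (U \<inter> X))" if "openin M X" for X
  proof -
    have "openin (subtopology M U) (U \<inter> X)"
      using that by (rule openin_subtopology_Int2)
    then have "openin (top_of_set (\<phi> ` U)) (\<phi> ` (U \<inter> X))"
      using homeomorphic_imp_open_map[OF hom] by (simp add: open_map_def)
    then show ?thesis using op by (simp add: openin_open_eq)
  qed
  show "openin M {x \<in> U. \<phi> x \<in> W}" if "open W" for W
  proof -
    have "openin (top_of_set (\<phi> ` U)) (\<phi> ` U \<inter> W)" using that by blast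
    from openin_continuous_map_preimage[OF homeomorphic_imp_continuous_map[OF hom] this]
    have "openin (subtopology M U) {x \<in> U. \<phi> x \<in> \<phi> ` U \<inter> W}" unfolding topU .
    moreover have "{x \<in> U. \<phi> x \<in> \<phi> ` U \<inter> W} = {x \<in> U. \<phi> x \<in> W}" by auto
    ultimately show ?thesis using U openin_trans_full by metis
  qed
qed

lemma chart_change_has_derivative:
  assumes "smooth_atlas M \<A>" "(U, \<phi>) \<in> \<A>" "(V, \<psi>) \<in> \<A>" "x \<in> U" "x \<in> V"
    and "(f \<circ> inv_into U \<phi> has_derivative D) (at (\<phi> x))"
  obtains T where "linear T" "(f \<circ> inv_into V \<psi> has_derivative D \<circ> T) (at (\<psi> x))"
proof -
  have chU: "is_chart M (U, \<phi>)" and chV: "is_chart M (V, \<psi>)"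
    using assms(1-3) by (auto simp: smooth_atlas_def)
  let ?S = "\<psi> ` (V \<inter> U)" and ?\<tau> = "\<phi> \<circ> inv_into V \<psi>"
  have "open ?S" using is_chart_open_image[OF chV is_chart_openin[OF chU]] .
  have "\<forall>(U, \<phi>)\<in>\<A>. \<forall>(V, \<psi>)\<in>\<A>. smooth_on (\<phi> ` (U \<inter> V)) (\<psi> \<circ> inv_into U \<phi>)"
    using assms(1) by (simp add: smooth_atlas_def)
  from bspec[OF this assms(3), simplified] have "smooth_on ?S ?\<tau>"
    using assms(2) by blast
  then have "Ck_on (Suc 0) ?S ?\<tau>" unfolding smooth_on_def by blast
  then have der: "(?\<tau> has_derivative frechet_derivative ?\<tau> (at (\<psi> x))) (at (\<psi> x))"
    by (rule Ck_on_SucD(1)) (use assms(4,5) in auto)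
  have inv: "inv_into V \<psi> (\<psi> y) = y" if "y \<in> V" for y
    using is_chart_inj_on[OF chV] that by simp
  have "((f \<circ> inv_into U \<phi>) \<circ> ?\<tau> has_derivative D \<circ> frechet_derivative ?\<tau> (at (\<psi> x))) (at (\<psi> x))"
    by (rule diff_chain_at[OF der]) (use assms(5,6) inv in simp)
  then have "(f \<circ> inv_into V \<psi> has_derivative D \<circ> frechet_derivative ?\<tau> (at (\<psi> x))) (at (\<psi> x))"
  proof (rule has_derivative_transform_within_open[OF _ \<open>open ?S\<close>])
    show "\<psi> x \<in> ?S" using assms(4,5) by auto
    fix z assume "z \<in> ?S"
    then obtain y where "y \<in> V" "y \<in> U" "z = \<psi> y" by auto
    then show "((f \<circ> inv_into U \<phi>) \<circ> ?\<tau>) z = (f \<circ> inv_into V \<psi>) z"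
      using is_chart_inj_on[OF chU] inv by simp
  qed
  with that has_derivative_linear[OF der] show ?thesis by blast
qed

lemma immersion_has_derivative:
  assumes "immersion \<A> f" "(U, \<phi>) \<in> \<A>" "x \<in> U"
  obtains D where "(f \<circ> inv_into U \<phi> has_derivative D) (at (\<phi> x))" "inj D"
proof -
  have "smooth_on (\<phi> ` U) (f \<circ> inv_into U \<phi>)"
    using assms by (auto simp: immersion_def smooth_map_def)
  then have "Ck_on (Suc 0) (\<phi> ` U) (f \<circ> inv_into U \<phi>)" unfolding smooth_on_def by blast
  from Ck_on_SucD(1)[OF this, of "\<phi> x"] that show ?thesis
    using assms by (fastforce simp: immersion_def)
qed

section \<open>Existence of the embedding\<close>

theorem theorem1p1:
  fixes M :: "'a topology"
    and \<A> :: "('a, 'm::finite) chart set"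
    and i :: "'a \<Rightarrow> real ^ 'l::finite"
    and idx :: "nat \<Rightarrow> 'l"
  assumes "closed_manifold M \<A>"
    and "topspace M \<noteq> {}"
    and "CARD('m) + 1 \<le> CARD('l)"
    and "smooth_embedding M \<A> i"
    and "bij_betw idx {1..CARD('l)} UNIV"
  shows "\<exists>p :: 'l \<Rightarrow> real ^ 'l.
           (\<forall>k\<in>{1..CARD('m) + 1}. p (idx k) \<in> i ` topspace M) \<and>
           smooth_embedding M \<A> (dist_sq_map p \<circ> i)"
proof -
  let ?K = "i ` topspace M"
  have atlas: "smooth_atlas M \<A>" and cpt: "compact_space M"
    using assms(1) by (auto simp: closed_manifold_def smooth_manifold_def)
  have imm: "immersion \<A> i"
    and hom_i: "homeomorphic_map M (top_of_set ?K) i"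
    using assms(4) by (auto simp: smooth_embedding_def embedding_map_def)
  have chart: "is_chart M (U, \<phi>)" if "(U, \<phi>) \<in> \<A>" for U \<phi>
    using atlas that by (auto simp: smooth_atlas_def)
  have cont_i: "continuous_map M euclidean i"
    using homeomorphic_imp_continuous_map[OF hom_i] by (simp add: continuous_map_in_subtopology)
  have inj_i: "inj_on i (topspace M)" using homeomorphic_imp_injective_map[OF hom_i] .
  have "compact ?K"
    using image_compactin[OF _ cont_i] cpt by (auto simp: compact_space_def)
  then have "?K \<noteq> UNIV" using compact_imp_bounded not_bounded_UNIV by metis
  then obtain a where a: "a \<notin> ?K" by blast
  \<comment> \<open>The extremal point: farthest from a point outside the image, so that \<open>n\<close> below is nonzero.\<close>
  obtain q where "q \<in> ?K" and far: "\<And>y. y \<in> ?K \<Longrightarrow> dist a y \<le> dist a q"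
    using distance_attains_sup[OF \<open>compact ?K\<close>, of a] assms(2) by blast
  then obtain x0 where x0: "x0 \<in> topspace M" "q = i x0" by blast
  define n where "n = q - a"
  have "n \<noteq> 0" using a \<open>q \<in> ?K\<close> by (auto simp: n_def)
  have cap: "(dist y q)\<^sup>2 \<le> 2 * (n \<bullet> q - n \<bullet> y)" if "y \<in> ?K" for y
    using cap_of_farthest_point[OF far[OF that]] by (simp add: n_def)
  have le_top: "n \<bullet> y \<le> n \<bullet> q" if "y \<in> ?K" for y
    using order_trans[OF zero_le_power2 cap[OF that]] by simp
  have less_top: "n \<bullet> y < n \<bullet> q" if "y \<in> ?K" "y \<noteq> q" for y
  proof -
    have "0 < (dist y q)\<^sup>2" using that(2) by simp
    from less_le_trans[OF this cap[OF that(1)]] show ?thesis by simp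
  qed

  obtain U \<phi> where U: "(U, \<phi>) \<in> \<A>" "x0 \<in> U"
    using atlas x0(1) unfolding smooth_atlas_def by blast
  note chU = chart[OF U(1)]
  have UM: "U \<subseteq> topspace M" using openin_subset[OF is_chart_openin[OF chU]] .
  define F where "F = i \<circ> inv_into U \<phi>"
  have F\<phi>: "F (\<phi> x) = i x" if "x \<in> U" for x
    using is_chart_inj_on[OF chU] that by (simp add: F_def)
  have opT: "open (\<phi> ` U)"
    using is_chart_open_image[OF chU is_chart_openin[OF chU]] by simp
  have "smooth_on (\<phi> ` U) F" using imm U(1) by (auto simp: immersion_def smooth_map_def F_def)
  then have Ck1: "Ck_on 1 (\<phi> ` U) F" by (simp only: smooth_on_def)
  then have derF: "(F has_derivative frechet_derivative F (at z)) (at z)" if "z \<in> \<phi> ` U" for z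
    using Ck_on_SucD(1)[of 0 "\<phi> ` U" F z] that by simp
  have inj0: "inj (frechet_derivative F (at (\<phi> x0)))"
    using imm U by (auto simp: immersion_def F_def)
  obtain L :: "real ^ 'l \<Rightarrow> real ^ 'm" and W V g where L: "linear L"
    and ker: "\<forall>n. (\<forall>v. n \<bullet> frechet_derivative F (at (\<phi> x0)) v = 0) \<longrightarrow> L n = 0"
    and W: "open W" "W \<subseteq> \<phi> ` U" "\<phi> x0 \<in> W" and V: "open V" "homeomorphism W V (L \<circ> F) g"
    and injW: "\<forall>z\<in>W. inj (\<lambda>v. L (frechet_derivative F (at z) v))"
    by (rule immersion_local_projection[OF opT Ck1 imageI[OF U(2)] inj0])
  have FK: "F z \<in> ?K" if z: "z \<in> W" for z
  proof -
    obtain x where "x \<in> U" "z = \<phi> x" using z W(2) by blast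
    then show ?thesis using F\<phi> UM by auto
  qed

  \<comment> \<open>The height has its maximum over the sheet at \<open>q\<close>, so \<open>n\<close> is normal to the sheet there.\<close>
  have "((\<lambda>z. n \<bullet> F z) has_derivative (\<lambda>v. n \<bullet> frechet_derivative F (at (\<phi> x0)) v)) (at (\<phi> x0))"
    using W by (intro has_derivative_inner_right derF) auto
  then have "(\<lambda>v. n \<bullet> frechet_derivative F (at (\<phi> x0)) v) = (\<lambda>v. 0)"
    by (rule differential_zero_maxmin[OF W(3,1)]) (use FK le_top F\<phi>[OF U(2)] x0 in auto)
  then have "L n = 0" using ker by metis

  \<comment> \<open>The part of the manifold covered by the sheet. It contains every point of height close to that
      of \<open>q\<close>: such points have images near \<open>q\<close>, and \<open>i\<close> is a homeomorphism onto its image.\<close>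
  define N where "N = {x \<in> U. \<phi> x \<in> W}"
  have N_inj: "x = y" if "x \<in> N" "y \<in> N" "i x - i y = s *\<^sub>R n" for x y s
  proof -
    have "L (i x - i y) = 0" using that(3) L \<open>L n = 0\<close> by (simp add: linear_scale)
    then have "(L \<circ> F) (\<phi> x) = (L \<circ> F) (\<phi> y)"
      using that(1,2) L F\<phi> by (simp add: N_def linear_diff)
    moreover have "inj_on (L \<circ> F) W" using V(2) unfolding homeomorphism_def by (metis inj_onI)
    ultimately have "\<phi> x = \<phi> y" using that(1,2) inj_onD[of "L \<circ> F" W "\<phi> x" "\<phi> y"] by (simp add: N_def)
    then show ?thesis using that(1,2) is_chart_inj_on[OF chU] by (auto simp: N_def dest: inj_onD)
  qed
  have "openin M N" unfolding N_def using is_chart_openin_preimage[OF chU W(1)] .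
  then have "openin (top_of_set ?K) (i ` N)"
    using homeomorphic_imp_open_map[OF hom_i] by (simp add: open_map_def)
  then obtain r where r: "r > 0" "\<And>y. y \<in> ?K \<Longrightarrow> dist y q < r \<Longrightarrow> y \<in> i ` N"
  proof -
    have "q \<in> i ` N" using x0 U W by (auto simp: N_def)
    with \<open>openin (top_of_set ?K) (i ` N)\<close> that show ?thesis
      unfolding openin_euclidean_subtopology_iff by (metis dist_commute)
  qed
  have near: "x \<in> N" if x: "x \<in> topspace M" "n \<bullet> q - r\<^sup>2 / 2 < n \<bullet> i x" for x
  proof -
    have "(dist (i x) q)\<^sup>2 < r\<^sup>2" using cap[of "i x"] x by auto
    then have "dist (i x) q < r" using r(1) by (meson less_imp_le power2_less_imp_less)
    then obtain y where y: "y \<in> N" "i x = i y" using r(2)[of "i x"] x(1) by auto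
    then have "y \<in> topspace M" using UM by (auto simp: N_def)
    then show ?thesis using inj_onD[OF inj_i y(2) x(1)] y(1) by simp
  qed

  have contF: "continuous_on W F"
    using Ck_on_Suc_imp_Ck_on[of 0 "\<phi> ` U" F] Ck1 continuous_on_subset[OF _ W(2)] by simp
  have ray: "\<forall>\<^sub>F \<epsilon> in at_right 0. \<exists>t z. t > 0 \<and> z \<in> W \<and> n \<bullet> F z = n \<bullet> F (\<phi> x0) - \<epsilon> \<and>
      L (F z) = L (F (\<phi> x0)) + t *\<^sub>R v" if "v \<noteq> 0" for v
    by (rule level_point_over_ray[OF V(2,1) W(3) contF _ that])
      (use less_top FK F\<phi>[OF U(2)] x0 in auto)
  let ?one = "\<Sum>k\<in>UNIV. axis k 1 :: real ^ 'm"
  have "?one $ undefined = 1" by (simp add: axis_def)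
  then have "- ?one \<noteq> 0" by (metis neg_equal_0_iff_equal zero_index zero_neq_one)
  \<comment> \<open>The hyperplane of the fold is placed at depth \<open>\<epsilon>\<close> below \<open>q\<close>. Mirror images of points of the
      manifold have depth at most \<open>2 \<epsilon>\<close>, which must stay below \<open>r\<^sup>2 / 2\<close> to keep them on the sheet.\<close>
  have "\<forall>\<^sub>F \<epsilon> in at_right 0. 0 < \<epsilon> \<and> \<epsilon> < r\<^sup>2 / 4 \<and>
      (\<exists>t z. t > 0 \<and> z \<in> W \<and> n \<bullet> F z = n \<bullet> F (\<phi> x0) - \<epsilon> \<and>
        L (F z) = L (F (\<phi> x0)) + t *\<^sub>R (- ?one)) \<and>
      (\<forall>k :: 'm. \<exists>t z. t > 0 \<and> z \<in> W \<and> n \<bullet> F z = n \<bullet> F (\<phi> x0) - \<epsilon> \<and>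
        L (F z) = L (F (\<phi> x0)) + t *\<^sub>R axis k 1)"
    using r(1) \<open>- ?one \<noteq> 0\<close>
    by (intro eventually_conj eventually_at_right_less order_tendstoD(2)[OF tendsto_ident_at]
        ray eventually_all_finite) (auto simp: axis_eq_0_iff)
  then obtain \<epsilon> where \<epsilon>: "0 < \<epsilon>" "\<epsilon> < r\<^sup>2 / 4"
    and ex0: "\<exists>t z. t > 0 \<and> z \<in> W \<and> n \<bullet> F z = n \<bullet> F (\<phi> x0) - \<epsilon> \<and>
        L (F z) = L (F (\<phi> x0)) + t *\<^sub>R (- ?one)"
    and exk: "\<And>k :: 'm. \<exists>t z. t > 0 \<and> z \<in> W \<and> n \<bullet> F z = n \<bullet> F (\<phi> x0) - \<epsilon> \<and>
        L (F z) = L (F (\<phi> x0)) + t *\<^sub>R axis k 1"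
    using eventually_happens'[OF trivial_limit_at_right_real] by blast
  define c where "c = n \<bullet> q - \<epsilon>"
  have c: "n \<bullet> F (\<phi> x0) - \<epsilon> = c" using F\<phi>[OF U(2)] x0 by (simp add: c_def)
  obtain s z' where z': "s > 0" "z' \<in> W" "n \<bullet> F z' = c" "L (F z') = L (F (\<phi> x0)) - s *\<^sub>R ?one"
    using ex0 c by auto
  obtain t z where z: "\<And>k. t k > 0" "\<And>k. z k \<in> W" "\<And>k. n \<bullet> F (z k) = c"
    "\<And>k :: 'm. L (F (z k)) = L (F (\<phi> x0)) + t k *\<^sub>R axis k 1"
    using exk c by metis
  note indep = independent_secants[where P = "\<lambda>k. F (z k)", OF L z(1,4) z'(1,4)]
  obtain p :: "'l \<Rightarrow> real ^ 'l"
    where pK: "\<forall>k\<in>{1..CARD('m) + 1}. p (idx k) \<in> insert (F z') (range (\<lambda>k. F (z k)))"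
    and pc: "\<forall>j. n \<bullet> p j = c"
    and pn: "\<forall>w. (\<forall>j j'. (p j - p j') \<bullet> w = 0) \<longrightarrow> (\<exists>s. w = s *\<^sub>R n)"
    by (rule affine_independent_extend_to_hyperplane[OF assms(5,3) \<open>n \<noteq> 0\<close> z(3) z'(3) indep])

  have "inj_on (dist_sq_map p \<circ> i) (topspace M)"
  proof (rule inj_onI, rule ccontr)
    fix x y assume xy: "x \<in> topspace M" "y \<in> topspace M" "x \<noteq> y"
      and eq: "(dist_sq_map p \<circ> i) x = (dist_sq_map p \<circ> i) y"
    have "dist (p j) (i x) = dist (p j) (i y)" for j
      using arg_cong[OF eq, of "\<lambda>v. v $ j"] by (simp add: dist_sq_map_def)
    moreover have "i x \<noteq> i y" using xy inj_i by (auto dest: inj_onD)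
    ultimately have mirror: "\<exists>s. i x - i y = s *\<^sub>R n" "n \<bullet> i x + n \<bullet> i y = 2 * c"
      using equidistant_imp_mirror[OF pc pn, where x="i x" and y="i y"] by blast+
    \<comment> \<open>The heights of \<open>x\<close> and \<open>y\<close> add up to \<open>2 c\<close> and neither exceeds that of \<open>q\<close>.\<close>
    have "x \<in> N" "y \<in> N"
      using mirror(2) le_top[of "i x"] le_top[of "i y"] xy \<epsilon> by (auto intro!: near simp: c_def)
    with mirror(1) xy(3) show False using N_inj by blast
  qed
  moreover have "continuous_map M euclidean (dist_sq_map p \<circ> i)"
  proof (rule continuous_map_compose[OF cont_i])
    show "continuous_map euclidean euclidean (dist_sq_map p)"
      unfolding dist_sq_map_def by (simp, intro continuous_intros)
  qed
  ultimately have "embedding_map M euclidean (dist_sq_map p \<circ> i)"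
    using cpt by (intro continuous_imp_embedding_map) auto
  moreover have "smooth_map \<A> (dist_sq_map p \<circ> i)"
    unfolding smooth_map_def
  proof clarify
    fix V \<psi> assume V: "(V, \<psi>) \<in> \<A>"
    have "open (\<psi> ` V)"
      using is_chart_open_image[OF chart is_chart_openin[OF chart], OF V V] by simp
    moreover have "smooth_on (\<psi> ` V) (i \<circ> inv_into V \<psi>)"
      using imm V by (auto simp: immersion_def smooth_map_def)
    ultimately show "smooth_on (\<psi> ` V) (dist_sq_map p \<circ> i \<circ> inv_into V \<psi>)"
      using smooth_on_dist_sq_map[of "\<psi> ` V" "i \<circ> inv_into V \<psi>" p] by (simp add: o_def)
  qed
  moreover have "inj (frechet_derivative (dist_sq_map p \<circ> i \<circ> inv_into V \<psi>) (at (\<psi> x)))"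
    if V: "(V, \<psi>) \<in> \<A>" and x: "x \<in> V" for V \<psi> x
  proof -
    let ?G = "i \<circ> inv_into V \<psi>"
    obtain D where D: "(?G has_derivative D) (at (\<psi> x))" "inj D"
      using immersion_has_derivative[OF imm V x] .
    have Gx: "?G (\<psi> x) = i x" using is_chart_inj_on[OF chart[OF V]] x by simp
    let ?E = "\<lambda>v. \<chi> j. 2 * ((i x - p j) \<bullet> D v)"
    have E: "(dist_sq_map p \<circ> i \<circ> inv_into V \<psi> has_derivative ?E) (at (\<psi> x))"
      using dist_sq_map_has_derivative[OF D(1), of p] unfolding Gx by (simp add: o_def)
    have "v = 0" if "?E v = 0" for v
    proof (rule ccontr)
      assume "v \<noteq> 0"
      then have "D v \<noteq> 0"
        using D has_derivative_linear[OF D(1)] linear_injective_0 by blast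
      moreover have "(i x - p j) \<bullet> D v = 0" for j
        using that by (simp add: vec_eq_iff)
      \<comment> \<open>A vector killed by the derivative would be normal to the hyperplane, at a point on it.\<close>
      ultimately have "\<exists>s. D v = s *\<^sub>R n" "n \<bullet> i x = c"
        using dist_sq_kernel[OF pc pn, where x="i x" and w="D v"] by blast+
      then obtain s where s: "D v = s *\<^sub>R n" by blast
      have "x \<in> topspace M" using x openin_subset[OF is_chart_openin[OF chart[OF V]]] by blast
      then have "x \<in> N" using \<open>n \<bullet> i x = c\<close> \<epsilon> by (auto intro!: near simp: c_def)
      then have xU: "x \<in> U" "\<phi> x \<in> W" by (auto simp: N_def)
      \<comment> \<open>The point \<open>x\<close> may be given in any chart; transversality of \<open>n\<close> is known in the chart \<open>\<phi>\<close>.\<close>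
      have "(i \<circ> inv_into U \<phi> has_derivative frechet_derivative F (at (\<phi> x))) (at (\<phi> x))"
        using derF[of "\<phi> x"] xU(1) unfolding F_def by blast
      then obtain T where "linear T"
        "(?G has_derivative frechet_derivative F (at (\<phi> x)) \<circ> T) (at (\<psi> x))"
        using chart_change_has_derivative[OF atlas U(1) V xU(1) x] by blast
      then have DT: "D = frechet_derivative F (at (\<phi> x)) \<circ> T"
        using D(1) has_derivative_unique by blast
      have lin: "linear (frechet_derivative F (at (\<phi> x)))"
        using derF[of "\<phi> x"] xU(1) has_derivative_linear by blast
      have "L (frechet_derivative F (at (\<phi> x)) (T v)) = L (frechet_derivative F (at (\<phi> x)) 0)"
        using s DT L lin \<open>L n = 0\<close> by (simp add: linear_scale linear_0)
      then have "T v = 0" using injD[OF bspec[OF injW xU(2)]] by blast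
      then have "D v = 0" using DT lin by (simp add: linear_0)
      with \<open>D v \<noteq> 0\<close> show False by simp
    qed
    then have "inj ?E" using linear_injective_0[OF has_derivative_linear[OF E]] by blast
    then show ?thesis using frechet_derivative_at[OF E] by metis
  qed
  ultimately have "smooth_embedding M \<A> (dist_sq_map p \<circ> i)"
    by (auto simp: smooth_embedding_def immersion_def)
  moreover have "\<forall>k\<in>{1..CARD('m) + 1}. p (idx k) \<in> ?K"
  proof
    fix k assume "k \<in> {1..CARD('m) + 1}"
    then have "p (idx k) \<in> insert (F z') (range (\<lambda>k. F (z k)))" by (rule bspec[OF pK])
    then show "p (idx k) \<in> ?K" using FK z(2) z'(2) by auto
  qed
  ultimately show ?thesis by blast
qed

end
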